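(* Let $G$ be a $d$-regular, undirected, aperiodic multigraph on $n$ vertices with a two-way labeling and $H$ be a regular multigraph on $d$ vertices with a two-way labeling and with $\lambda(H)\leq \alpha$. Then \[ L(G^{2})\approx_{\epsilon} L(G\circledS H) \] for $\epsilon=\ln(1/(1-\alpha))$.
   Context: For a regular undirected multigraph $G$ with transition matrix $M$ (adjacency matrix divided by the degree), $L(G)=I-M$ is its normalized Laplacian, and $\lambda(G)=\max_{v\perp\vec{1},v\neq 0}\|Mv\|/\|v\|$ is the second largest absolute value of an eigenvalue of $M$. $G^2$ is the multigraph whose edges correspond to walks of length 2 in $G$ (transition matrix $M^2$). For symmetric matrices $X,Y$, $X\approx_\epsilon Y$ means $e^{-\epsilon}X\preceq Y\preceq e^{\epsilon}X$ in the positive semidefinite order. A two-way labeling of a $d$-regular multigraph gives each edge a label in $[d]$ at each endpoint, with distinct labels at each vertex; its rotation map $\mathrm{Rot}_G:[n]\times[d]\to[n]\times[d]$ sends $(v,i)$ to $(w,j)$ if the $i$th edge at $v$ leads to $w$ and is the $j$th edge at $w$. For $H$ $c$-regular on $d$ vertices, the derandomized square $G\circledS H$ is the $(d\cdot c)$-regular multigraph on $n$ vertices with rotation map: on input $(v_0,(i_0,j_0))$, let $(v_1,i_1)=\mathrm{Rot}_G(v_0,i_0)$, $(i_2,j_1)=\mathrm{Rot}_H(i_1,j_0)$, $(v_2,i_3)=\mathrm{Rot}_G(v_1,i_2)$, and output $(v_2,(i_3,j_1))$. *)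

theory Defs
  imports
    "HOL-Analysis.Analysis"
    "Graph_Theory.Digraph"
    "Graph_Theory.Arc_Walk"
begin

text \<open>
  The vertex set of a graph is the universe of a finite type, so that its matrices are indexed by
  that type. An undirected multigraph is a digraph in which every arc has a reverse; an undirected
  edge is an orbit \<open>{a, r a}\<close> of the reversal \<open>r\<close>. A loop may be a single arc with \<open>r a = a\<close>
  (counted once in the degree) or a pair of arcs (counted twice). The first kind is needed: it is
  how a two-step walk that returns along the same edge appears in the square of a graph.
\<close>

locale undirected_multigraph = fin_digraph G
  for G :: "('v::finite, 'e) pre_digraph" +
  fixes r :: "'e \<Rightarrow> 'e"
  assumes verts_UNIV: "verts G = UNIV"
    and rev_in_arcs: "a \<in> arcs G \<Longrightarrow> r a \<in> arcs G"
    and rev_rev: "a \<in> arcs G \<Longrightarrow> r (r a) = a"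
    and tail_rev: "a \<in> arcs G \<Longrightarrow> tail G (r a) = head G a"

definition regular :: "('v, 'e) pre_digraph \<Rightarrow> nat \<Rightarrow> bool" where
  "regular G d \<longleftrightarrow> (\<forall>v\<in>verts G. out_degree G v = d)"

text \<open>
  The closed walks range over all vertices of the graph. A walk may use an arc and then its reverse.
\<close>

definition aperiodic :: "('v, 'e) pre_digraph \<Rightarrow> bool" where
  "aperiodic G \<longleftrightarrow> Gcd {length p | u p. pre_digraph.awalk G u p u} = 1"


definition adjacency_matrix :: "('v::finite, 'e) pre_digraph \<Rightarrow> real^'v^'v" where
  "adjacency_matrix G = (\<chi> u v. real (card {a \<in> arcs G. tail G a = u \<and> head G a = v}))"

definition transition_matrix :: "('v::finite, 'e) pre_digraph \<Rightarrow> real^'v^'v" where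
  "transition_matrix G = (\<chi> u v. adjacency_matrix G $ u $ v / real (out_degree G u))"

definition laplacian :: "('v::finite, 'e) pre_digraph \<Rightarrow> real^'v^'v" where
  "laplacian G = mat 1 - transition_matrix G"

text \<open>
  All the quotients are nonnegative, so inserting 0 only matters for a graph with a single vertex,
  where there is no nonzero vector orthogonal to 1 and \<open>\<lambda>(G)\<close> is 0 by convention.
\<close>

definition lambda :: "('v::finite, 'e) pre_digraph \<Rightarrow> real" where
  "lambda G =
     Sup (insert 0 {norm (transition_matrix G *v x) / norm x | x :: real^'v. x \<bullet> 1 = 0 \<and> x \<noteq> 0})"


definition psd :: "real^'v^'v \<Rightarrow> bool" where
  "psd A \<longleftrightarrow> transpose A = A \<and> (\<forall>x. 0 \<le> x \<bullet> (A *v x))"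

definition loewner_le :: "real^'v^'v \<Rightarrow> real^'v^'v \<Rightarrow> bool" where
  "loewner_le A B \<longleftrightarrow> psd (B - A)"

definition spectral_approx :: "real \<Rightarrow> real^'v^'v \<Rightarrow> real^'v^'v \<Rightarrow> bool" where
  "spectral_approx \<epsilon> X Y \<longleftrightarrow>
     loewner_le (exp (- \<epsilon>) *\<^sub>R X) Y \<and> loewner_le Y (exp \<epsilon> *\<^sub>R X)"


definition square :: "('v, 'e) pre_digraph \<Rightarrow> ('v, 'e \<times> 'e) pre_digraph" where
  "square G = \<lparr> verts = verts G,
     arcs = {(a, b). a \<in> arcs G \<and> b \<in> arcs G \<and> head G a = tail G b},
     tail = (\<lambda>(a, b). tail G a), head = (\<lambda>(a, b). head G b) \<rparr>"

text \<open>
  Labels are elements of a finite type \<open>'d\<close>, in place of \<open>[d]\<close>. The label of an edge at its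
  endpoint \<open>v\<close> is the label of the corresponding arc with tail \<open>v\<close>; its label at the other endpoint
  is that of the reverse arc.
\<close>

definition two_way_labeling :: "('v, 'e) pre_digraph \<Rightarrow> ('e \<Rightarrow> 'd::finite) \<Rightarrow> bool" where
  "two_way_labeling G l \<longleftrightarrow> regular G CARD('d) \<and> (\<forall>v\<in>verts G. inj_on l (out_arcs G v))"

definition rotation_map ::
  "('v, 'e) pre_digraph \<Rightarrow> ('e \<Rightarrow> 'e) \<Rightarrow> ('e \<Rightarrow> 'd) \<Rightarrow> 'v \<times> 'd \<Rightarrow> 'v \<times> 'd" where
  "rotation_map G r l = (\<lambda>(v, i).
     let a = (THE a. a \<in> out_arcs G v \<and> l a = i) in (head G a, l (r a)))"

text \<open>
  The multigraph with a given rotation map \<open>R\<close>: the arc \<open>(v, i)\<close> is the \<open>i\<close>th edge at \<open>v\<close>, and \<open>R\<close>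
  itself is the reversal.
\<close>

definition rot_multigraph :: "('v \<times> 'd \<Rightarrow> 'v \<times> 'd) \<Rightarrow> ('v, 'v \<times> 'd) pre_digraph" where
  "rot_multigraph R = \<lparr> verts = UNIV, arcs = UNIV, tail = fst, head = (\<lambda>e. fst (R e)) \<rparr>"

definition derand_rot ::
  "('v \<times> 'd \<Rightarrow> 'v \<times> 'd) \<Rightarrow> ('d \<times> 'c \<Rightarrow> 'd \<times> 'c) \<Rightarrow> 'v \<times> ('d \<times> 'c) \<Rightarrow> 'v \<times> ('d \<times> 'c)" where
  "derand_rot RG RH = (\<lambda>(v0, (i0, j0)).
     let (v1, i1) = RG (v0, i0);
         (i2, j1) = RH (i1, j0);
         (v2, i3) = RG (v1, i2)
     in (v2, (i3, j1)))"

definition derandomized_square ::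
  "('v, 'e) pre_digraph \<Rightarrow> ('e \<Rightarrow> 'e) \<Rightarrow> ('e \<Rightarrow> 'd) \<Rightarrow>
   ('d, 'f) pre_digraph \<Rightarrow> ('f \<Rightarrow> 'f) \<Rightarrow> ('f \<Rightarrow> 'c) \<Rightarrow> ('v, 'v \<times> ('d \<times> 'c)) pre_digraph" where
  "derandomized_square G rG lG H rH lH =
     rot_multigraph (derand_rot (rotation_map G rG lG) (rotation_map H rH lH))"


text \<open>The constructions above stay within undirected multigraphs with two-way labelings.\<close>

lemma (in undirected_multigraph) head_rev: "a \<in> arcs G \<Longrightarrow> head G (r a) = tail G a"
  using tail_rev[OF rev_in_arcs, of a] by (simp add: rev_rev)

lemma (in undirected_multigraph) undirected_square:
  "undirected_multigraph (square G) (\<lambda>(a, b). (r b, r a))"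
proof
  have "arcs (square G) \<subseteq> arcs G \<times> arcs G"
    by (auto simp: square_def)
  then show "finite (arcs (square G))"
    by (rule finite_subset) simp
next
  show "verts (square G) = UNIV"
    by (simp add: square_def verts_UNIV)
next
  fix e assume "e \<in> arcs (square G)"
  then obtain a b where e: "e = (a, b)"
    and ab: "a \<in> arcs G" "b \<in> arcs G" "head G a = tail G b"
    by (auto simp: square_def)
  show "tail (square G) e \<in> verts (square G)" "head (square G) e \<in> verts (square G)"
    using e ab by (simp_all add: square_def)
  show "(case e of (a, b) \<Rightarrow> (r b, r a)) \<in> arcs (square G)"
    using e ab by (simp add: square_def rev_in_arcs tail_rev head_rev)
  show "(case (case e of (a, b) \<Rightarrow> (r b, r a)) of (a, b) \<Rightarrow> (r b, r a)) = e"
    using e ab by (simp add: rev_rev)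
  show "tail (square G) (case e of (a, b) \<Rightarrow> (r b, r a)) = head (square G) e"
    using e ab by (simp add: square_def tail_rev)
next
  show "finite (verts (square G))"
    by simp
qed

lemma two_way_labeling_bij:
  fixes l :: "'e \<Rightarrow> 'd::finite"
  assumes "two_way_labeling G l" "v \<in> verts G"
  shows "bij_betw l (out_arcs G v) UNIV"
proof -
  have inj: "inj_on l (out_arcs G v)" and deg: "card (out_arcs G v) = CARD('d)"
    using assms by (auto simp: two_way_labeling_def regular_def out_degree_def)
  then have "card (l ` out_arcs G v) = CARD('d)"
    by (simp add: card_image)
  then have "l ` out_arcs G v = UNIV"
    by (intro card_subset_eq) auto
  with inj show ?thesis by (simp add: bij_betw_def)
qed

lemma rotation_map_arc:
  assumes "two_way_labeling G l" "a \<in> arcs G" "tail G a \<in> verts G"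
  shows "rotation_map G r l (tail G a, l a) = (head G a, l (r a))"
proof -
  have inj: "inj_on l (out_arcs G (tail G a))"
    using assms by (auto simp: two_way_labeling_def)
  have "(THE b. b \<in> out_arcs G (tail G a) \<and> l b = l a) = a"
    using inj assms(2) by (intro the_equality) (auto simp: inj_on_def out_arcs_def)
  then show ?thesis by (simp add: rotation_map_def)
qed

lemma (in undirected_multigraph) rotation_map_involution:
  fixes l :: "'e \<Rightarrow> 'd::finite"
  assumes "two_way_labeling G l"
  shows "rotation_map G r l (rotation_map G r l e) = e"
proof -
  obtain v i where e: "e = (v, i)" by (cases e)
  have "bij_betw l (out_arcs G v) UNIV"
    using two_way_labeling_bij[OF assms] verts_UNIV by auto
  then have "i \<in> l ` out_arcs G v"
    by (simp add: bij_betw_def)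
  then obtain a where a: "a \<in> arcs G" "tail G a = v" "l a = i"
    by (auto simp: out_arcs_def)
  have "rotation_map G r l (v, i) = (head G a, l (r a))"
    using rotation_map_arc[OF assms a(1)] a verts_UNIV by simp
  moreover have "rotation_map G r l (tail G (r a), l (r a)) = (head G (r a), l (r (r a)))"
    using rotation_map_arc[OF assms rev_in_arcs[OF a(1)]] verts_UNIV by simp
  ultimately show ?thesis
    using a e by (simp add: tail_rev head_rev rev_rev)
qed

lemma derand_rot_involution:
  assumes "\<And>e. RG (RG e) = e" "\<And>e. RH (RH e) = e"
  shows "derand_rot RG RH (derand_rot RG RH e) = e"
proof -
  obtain v0 i0 j0 where e: "e = (v0, (i0, j0))" by (cases e) auto
  obtain v1 i1 where 1: "RG (v0, i0) = (v1, i1)" by (cases "RG (v0, i0)")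
  obtain i2 j1 where 2: "RH (i1, j0) = (i2, j1)" by (cases "RH (i1, j0)")
  obtain v2 i3 where 3: "RG (v1, i2) = (v2, i3)" by (cases "RG (v1, i2)")
  have "RG (v1, i1) = (v0, i0)" "RH (i2, j1) = (i1, j0)" "RG (v2, i3) = (v1, i2)"
    using assms(1)[of "(v0, i0)"] assms(2)[of "(i1, j0)"] assms(1)[of "(v1, i2)"] 1 2 3
    by simp_all
  with e 1 2 3 show ?thesis
    by (simp add: derand_rot_def)
qed

lemma undirected_rot_multigraph:
  fixes R :: "'v::finite \<times> 'd::finite \<Rightarrow> 'v \<times> 'd"
  assumes "\<And>e. R (R e) = e"
  shows "undirected_multigraph (rot_multigraph R) R"
  by unfold_locales (auto simp: rot_multigraph_def assms)

lemma two_way_labeling_rot_multigraph: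
  fixes R :: "'v::finite \<times> 'd::finite \<Rightarrow> 'v \<times> 'd"
  shows "two_way_labeling (rot_multigraph R) snd"
proof -
  have "out_arcs (rot_multigraph R) v = {v} \<times> UNIV" for v
    by (auto simp: out_arcs_def rot_multigraph_def)
  then show ?thesis
    by (auto simp: two_way_labeling_def regular_def out_degree_def inj_on_def)
qed

lemma rotation_map_rot_multigraph:
  fixes R :: "'v::finite \<times> 'd::finite \<Rightarrow> 'v \<times> 'd"
  shows "rotation_map (rot_multigraph R) R snd = R"
proof
  fix e
  show "rotation_map (rot_multigraph R) R snd e = R e"
    using rotation_map_arc[OF two_way_labeling_rot_multigraph, of e R R]
    by (simp add: rot_multigraph_def)
qed

end

(* Lift f on the vertices of G to the cloud of each vertex v by g_v(i) = f(i-th neighbour of v).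
   Because the rotation map of G is an involution, the quadratic forms of both Laplacians split over
   the clouds: that of the square is 1/d times the sum over v of |h_v|^2 with h_v = g_v - mean(g_v)
   (the complete graph with loops acts on each cloud), and that of the derandomized square is 1/d
   times the sum of h_v . (I - M_H) h_v. Since h_v is orthogonal to 1, the latter summand lies
   between 1 - alpha and 1 + alpha <= 1 / (1 - alpha) times the former. *)

theory Submission
  imports Defs
begin

section \<open>Quadratic forms of transition matrices and Laplacians as sums over arcs\<close>

lemma (in undirected_multigraph) bij_betw_rev: "bij_betw r (arcs G) (arcs G)"
  by (rule bij_betw_byWitness[where f' = r]) (auto simp: rev_rev rev_in_arcs)

lemma (in undirected_multigraph) inner_transition_matrix:
  fixes x y :: "real^'v"
  assumes "regular G d"
  shows "x \<bullet> (transition_matrix G *v y)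
    = (\<Sum>a\<in>arcs G. x $ tail G a * y $ head G a) / real d"
proof -
  have deg: "out_degree G u = d" for u
    using assms by (simp add: regular_def verts_UNIV)
  have "x \<bullet> (transition_matrix G *v y)
    = (\<Sum>u\<in>UNIV. \<Sum>v\<in>UNIV. \<Sum>a | a \<in> arcs G \<and> tail G a = u \<and> head G a = v.
         x $ tail G a * y $ head G a / real d)"
    by (simp add: inner_vec_def matrix_vector_mult_def transition_matrix_def adjacency_matrix_def
        deg sum_distrib_left mult_ac)
  \<comment> \<open>Both vertex indices merge into one, so that \<open>sum.group\<close> can collect
    the arcs by their pair of endpoints.\<close>
  also have "\<dots> = (\<Sum>p\<in>UNIV. \<Sum>a | a \<in> arcs G \<and> (tail G a, head G a) = p.
         x $ tail G a * y $ head G a / real d)"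
    by (simp add: sum.cartesian_product case_prod_beta prod_eq_iff flip: UNIV_Times_UNIV)
  also have "\<dots> = (\<Sum>a\<in>arcs G. x $ tail G a * y $ head G a / real d)"
    by (rule sum.group) auto
  finally show ?thesis
    by (simp add: sum_divide_distrib)
qed

lemma inner_laplacian:
  "x \<bullet> (laplacian G *v y) = x \<bullet> y - x \<bullet> (transition_matrix G *v y)"
  by (simp add: laplacian_def matrix_vector_mult_diff_rdistrib inner_diff_right)

text \<open>Reindexing the arc sum by the reversal \<open>r\<close> exchanges tails and
  heads.\<close>

lemma (in undirected_multigraph) inner_transition_matrix_commute:
  fixes x y :: "real^'v"
  assumes "regular G d"
  shows "x \<bullet> (transition_matrix G *v y) = y \<bullet> (transition_matrix G *v x)"
proof -
  have "(\<Sum>a\<in>arcs G. x $ tail G a * y $ head G a)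
    = (\<Sum>a\<in>arcs G. x $ tail G (r a) * y $ head G (r a))"
    using sum.reindex_bij_betw[OF bij_betw_rev, of "\<lambda>a. x $ tail G a * y $ head G a"] by simp
  also have "\<dots> = (\<Sum>a\<in>arcs G. y $ tail G a * x $ head G a)"
    by (intro sum.cong) (auto simp: tail_rev head_rev)
  finally show ?thesis
    by (simp add: inner_transition_matrix[OF assms])
qed

text \<open>Comparing quadratic forms does not suffice for \<open>loewner_le\<close>:
  \<open>psd\<close> also asks for a symmetric matrix.\<close>

lemma (in undirected_multigraph) transpose_laplacian:
  assumes "regular G d"
  shows "transpose (laplacian G) = laplacian G"
proof -
  have "x \<bullet> (transpose (laplacian G) *v y) = x \<bullet> (laplacian G *v y)" for x y
  proof -
    have "x \<bullet> (transpose (laplacian G) *v y) = y \<bullet> (laplacian G *v x)"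
      by (metis dot_lmul_matrix inner_commute transpose_matrix_vector)
    then show ?thesis
      using inner_transition_matrix_commute[OF assms, of x y]
      by (simp add: inner_laplacian inner_commute)
  qed
  then show ?thesis
    by (metis matrix_eq vector_eq_ldot)
qed

section \<open>Labels as coordinates on the arcs\<close>

lemma (in undirected_multigraph) obtain_arc:
  fixes l :: "'e \<Rightarrow> 'd::finite"
  assumes "two_way_labeling G l"
  obtains a where "a \<in> arcs G" "tail G a = v" "l a = i"
proof -
  have "i \<in> l ` out_arcs G v"
    using two_way_labeling_bij[OF assms, of v] verts_UNIV by (simp add: bij_betw_def)
  with that show thesis
    by (auto simp: out_arcs_def)
qed

text \<open>This turns arc sums into sums over vertex-label pairs, the domain on which the rotation
  map acts.\<close>

lemma (in undirected_multigraph) bij_betw_arcs_labels: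
  fixes l :: "'e \<Rightarrow> 'd::finite"
  assumes "two_way_labeling G l"
  shows "bij_betw (\<lambda>a. (tail G a, l a)) (arcs G) UNIV"
  unfolding bij_betw_def
proof
  have bij: "bij_betw l (out_arcs G v) UNIV" for v
    using two_way_labeling_bij[OF assms] verts_UNIV by auto
  then show "inj_on (\<lambda>a. (tail G a, l a)) (arcs G)"
    by (fastforce simp: inj_on_def bij_betw_def out_arcs_def)
  have "(v, i) \<in> (\<lambda>a. (tail G a, l a)) ` arcs G" for v i
    by (rule obtain_arc[OF assms, of v i]) auto
  then show "(\<lambda>a. (tail G a, l a)) ` arcs G = UNIV"
    by auto
qed

lemma (in undirected_multigraph) fst_rotation_map:
  assumes "two_way_labeling G l" "a \<in> arcs G"
  shows "fst (rotation_map G r l (tail G a, l a)) = head G a"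
  using rotation_map_arc[OF assms] verts_UNIV by simp

lemma (in undirected_multigraph) inner_transition_matrix_labels:
  fixes l :: "'e \<Rightarrow> 'd::finite" and x y :: "real^'v"
  assumes "two_way_labeling G l"
  shows "x \<bullet> (transition_matrix G *v y)
    = (\<Sum>v\<in>UNIV. \<Sum>i\<in>UNIV. x $ v * y $ fst (rotation_map G r l (v, i))) / real CARD('d)"
proof -
  have "(\<Sum>a\<in>arcs G. x $ tail G a * y $ head G a)
    = (\<Sum>a\<in>arcs G. (\<lambda>p. x $ fst p * y $ fst (rotation_map G r l p)) (tail G a, l a))"
    by (intro sum.cong) (simp_all add: fst_rotation_map[OF assms])
  also have "\<dots> = (\<Sum>p\<in>UNIV. x $ fst p * y $ fst (rotation_map G r l p))"
    by (rule sum.reindex_bij_betw[OF bij_betw_arcs_labels[OF assms]])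
  also have "\<dots> = (\<Sum>v\<in>UNIV. \<Sum>i\<in>UNIV. x $ v * y $ fst (rotation_map G r l (v, i)))"
    by (simp add: sum.cartesian_product case_prod_beta flip: UNIV_Times_UNIV)
  moreover have "regular G CARD('d)"
    using assms by (simp add: two_way_labeling_def)
  ultimately show ?thesis
    by (simp add: inner_transition_matrix)
qed

section \<open>Bounding the Laplacian form of a single graph by \<open>lambda\<close>\<close>

lemma (in undirected_multigraph) transition_matrix_mult_one:
  fixes l :: "'e \<Rightarrow> 'd::finite"
  assumes "two_way_labeling G l"
  shows "transition_matrix G *v 1 = 1"
proof -
  have "x \<bullet> 1 = (\<Sum>v\<in>UNIV. x $ v)" for x :: "real^'v"
    by (simp add: inner_vec_def)
  \<comment> \<open>The degree \<open>CARD('d)\<close> cancels because a finite type has positive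
    cardinality.\<close>
  then have "x \<bullet> (transition_matrix G *v 1) = x \<bullet> 1" for x
    by (simp add: inner_transition_matrix_labels[OF assms] flip: sum_distrib_left)
  then show ?thesis
    by (metis vector_eq_ldot)
qed

text \<open>The operator norm bounds every quotient. Without an upper bound, the real
  \<open>Sup\<close> in \<open>lambda\<close> would carry no information.\<close>

lemma bdd_above_lambda:
  fixes G :: "('v::finite, 'e) pre_digraph"
  shows "bdd_above (insert 0
    {norm (transition_matrix G *v x) / norm x | x :: real^'v. x \<bullet> 1 = 0 \<and> x \<noteq> 0})"
  using matrix_vector_mul_bounded_linear[of "transition_matrix G"]
  by (intro bdd_aboveI[of _ "onorm ((*v) (transition_matrix G))"])
    (auto simp: onorm_pos_le intro: le_onorm)

lemma norm_transition_matrix_le_lambda: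
  fixes G :: "('v::finite, 'e) pre_digraph" and x :: "real^'v"
  assumes "x \<bullet> 1 = 0"
  shows "norm (transition_matrix G *v x) \<le> lambda G * norm x"
proof (cases "x = 0")
  case False
  with assms have "norm (transition_matrix G *v x) / norm x \<le> lambda G"
    unfolding lambda_def by (intro cSup_upper bdd_above_lambda) auto
  with False show ?thesis
    by (simp add: divide_le_eq)
qed simp

text \<open>The inserted 0 settles this even for a one-vertex graph, where there are no
  quotients.\<close>

lemma lambda_nonneg: "0 \<le> lambda G"
  unfolding lambda_def by (intro cSup_upper bdd_above_lambda) simp

text \<open>\<open>V\<close> is the squared norm of the part of \<open>y\<close> orthogonal to the
  constants, and the Laplacian form depends on that part only. \<open>V\<close> is written with
  inner products to match the summands of the form of the square; the lemma is meant for
  \<open>H\<close> and the cloud vectors.\<close>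

lemma (in undirected_multigraph) laplacian_form_bounds:
  fixes l :: "'e \<Rightarrow> 'd::finite" and y :: "real^'v"
  assumes lab: "two_way_labeling G l" and \<alpha>: "lambda G \<le> \<alpha>"
  defines "V \<equiv> y \<bullet> y - (y \<bullet> 1)\<^sup>2 / real CARD('v)"
  shows "0 \<le> V"
    and "(1 - \<alpha>) * V \<le> y \<bullet> (laplacian G *v y)"
    and "y \<bullet> (laplacian G *v y) \<le> (1 + \<alpha>) * V"
proof -
  define M where "M = transition_matrix G"
  define m where "m = (y \<bullet> 1) / real CARD('v)"
  define h where "h = y - m *\<^sub>R 1"
  have reg: "regular G CARD('d)"
    using lab by (simp add: two_way_labeling_def)
  have one: "M *v 1 = 1"
    unfolding M_def by (rule transition_matrix_mult_one[OF lab])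
  \<comment> \<open>By symmetry, \<open>M\<close> preserves orthogonality to the constants.\<close>
  have oneM: "1 \<bullet> (M *v z) = z \<bullet> 1" for z
    using inner_transition_matrix_commute[OF reg, of 1 z] one by (simp add: M_def)
  have one_one: "(1 :: real^'v) \<bullet> 1 = real CARD('v)"
    by (simp add: inner_vec_def)
  have y1: "y \<bullet> 1 = m * real CARD('v)"
    by (simp add: m_def)
  have orth: "h \<bullet> 1 = 0"
    by (simp add: h_def inner_diff_left one_one y1)
  have y: "y = h + m *\<^sub>R 1"
    by (simp add: h_def)
  have V: "V = h \<bullet> h"
    by (simp add: V_def h_def inner_diff_left inner_diff_right one_one y1 inner_commute[of 1 y]
        power2_eq_square)
  have "M *v y = M *v h + m *\<^sub>R 1"
    by (simp add: y matrix_vector_right_distrib matrix_vector_mult_scaleR one)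
  \<comment> \<open>The cross terms between \<open>h\<close> and the constant part vanish, and the
    purely constant terms cancel.\<close>
  then have L: "y \<bullet> (laplacian G *v y) = h \<bullet> h - h \<bullet> (M *v h)"
    using orth oneM[of h]
    by (simp add: inner_laplacian y inner_add_left inner_add_right inner_commute[of 1 h]
        flip: M_def)
  have "\<bar>h \<bullet> (M *v h)\<bar> \<le> norm h * norm (M *v h)"
    by (rule Cauchy_Schwarz_ineq2)
  also have "\<dots> \<le> norm h * (\<alpha> * norm h)"
    using norm_transition_matrix_le_lambda[OF orth, of G] mult_right_mono[OF \<alpha>, of "norm h"]
    by (intro mult_left_mono) (auto simp: M_def)
  also have "\<dots> = \<alpha> * (h \<bullet> h)"
    by (simp add: dot_square_norm power2_eq_square)
  finally have "\<bar>h \<bullet> (M *v h)\<bar> \<le> \<alpha> * (h \<bullet> h)" .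
  then show "0 \<le> V" "(1 - \<alpha>) * V \<le> y \<bullet> (laplacian G *v y)"
    "y \<bullet> (laplacian G *v y) \<le> (1 + \<alpha>) * V"
    unfolding V L by (auto simp: algebra_simps)
qed

section \<open>The forms of both squares, decomposed over the clouds\<close>

lemma regular_square:
  assumes "undirected_multigraph G r" and "regular G d"
  shows "regular (square G) (d * d)"
proof -
  interpret undirected_multigraph G r by fact
  have "out_arcs (square G) v = (SIGMA a:out_arcs G v. out_arcs G (head G a))" for v
    by (auto simp: out_arcs_def square_def)
  moreover have "card (out_arcs G v) = d" for v
    using assms(2) by (simp add: regular_def out_degree_def verts_UNIV)
  moreover have "finite (out_arcs G v)" for v
    by (rule finite_subset[of _ "arcs G"]) (auto simp: out_arcs_def)
  ultimately show ?thesis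
    by (simp add: regular_def out_degree_def)
qed

context undirected_multigraph
begin

text \<open>The labels at \<open>v\<close> serve as the vertices of \<open>H\<close>, so the
  matrices of \<open>H\<close> act on this vector.\<close>

definition cloud :: "('e \<Rightarrow> 'd::finite) \<Rightarrow> real^'v \<Rightarrow> 'v \<Rightarrow> real^'d" where
  "cloud l x v = (\<chi> i. x $ fst (rotation_map G r l (v, i)))"

lemma bij_rotation_map:
  fixes l :: "'e \<Rightarrow> 'd::finite"
  assumes "two_way_labeling G l"
  shows "bij (rotation_map G r l)"
  using rotation_map_involution[OF assms] by (intro o_bij[of "rotation_map G r l"]) auto

text \<open>Substituting the rotation map, which is its own inverse, moves the outer summation from
  the start of an edge to its other end. For a two-step walk, this makes the middle vertex the outer
  index.\<close>

lemma sum_rotation_map: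
  fixes l :: "'e \<Rightarrow> 'd::finite" and F :: "'v \<Rightarrow> 'v \<times> 'd \<Rightarrow> real"
  assumes "two_way_labeling G l"
  shows "(\<Sum>v\<in>UNIV. \<Sum>i\<in>UNIV. F v (rotation_map G r l (v, i)))
    = (\<Sum>v\<in>UNIV. \<Sum>i\<in>UNIV. F (fst (rotation_map G r l (v, i))) (v, i))"
proof -
  let ?R = "rotation_map G r l"
  have "(\<Sum>p\<in>UNIV. F (fst p) (?R p)) = (\<Sum>p\<in>UNIV. F (fst (?R p)) (?R (?R p)))"
    using sum.reindex_bij_betw[OF bij_rotation_map[OF assms], of "\<lambda>p. F (fst p) (?R p)"] by simp
  then show ?thesis
    by (simp add: rotation_map_involution[OF assms] sum.cartesian_product case_prod_beta
        flip: UNIV_Times_UNIV)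
qed

text \<open>The square of \<open>x $ u\<close> is counted once for each of the
  \<open>CARD('d)\<close> labeled edges at \<open>u\<close>.\<close>

lemma sum_inner_cloud:
  fixes l :: "'e \<Rightarrow> 'd::finite"
  assumes "two_way_labeling G l"
  shows "(\<Sum>v\<in>UNIV. cloud l x v \<bullet> cloud l x v) = real CARD('d) * (x \<bullet> x)"
  using sum_rotation_map[OF assms, of "\<lambda>v p. x $ v * x $ v"]
  by (simp add: cloud_def inner_vec_def sum_distrib_left)

lemma inner_laplacian_square:
  fixes l :: "'e \<Rightarrow> 'd::finite"
  assumes lab: "two_way_labeling G l"
  shows "x \<bullet> (laplacian (square G) *v x)
    = (\<Sum>v\<in>UNIV. cloud l x v \<bullet> cloud l x v - (cloud l x v \<bullet> 1)\<^sup>2 / real CARD('d)) / real CARD('d)"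
proof -
  let ?R = "rotation_map G r l"
  interpret sq: undirected_multigraph "square G" "\<lambda>(a, b). (r b, r a)"
    by (rule undirected_square)
  have reg: "regular (square G) (CARD('d) * CARD('d))"
    using lab undirected_multigraph_axioms by (auto simp: two_way_labeling_def intro: regular_square)
  \<comment> \<open>A two-step walk is encoded by its middle vertex and the labels there of its two
    edges; the first edge is read backwards.\<close>
  define \<phi> where "\<phi> = (\<lambda>(a, b). (tail G b, l (r a), l b))"
  have inj: "a = b" if "tail G a = tail G b" "l a = l b" "a \<in> arcs G" "b \<in> arcs G" for a b
    using bij_betw_arcs_labels[OF lab] that by (auto simp: bij_betw_def inj_on_def)
  have bij: "bij_betw \<phi> (arcs (square G)) UNIV"
    unfolding bij_betw_def
  proof
    show "inj_on \<phi> (arcs (square G))"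
    proof (rule inj_onI, clarify)
      fix a b a' b'
      assume "(a, b) \<in> arcs (square G)" "(a', b') \<in> arcs (square G)" "\<phi> (a, b) = \<phi> (a', b')"
      then have *: "a \<in> arcs G" "b \<in> arcs G" "a' \<in> arcs G" "b' \<in> arcs G"
        "head G a = tail G b" "head G a' = tail G b'"
        "tail G b = tail G b'" "l (r a) = l (r a')" "l b = l b'"
        by (auto simp: square_def \<phi>_def)
      \<comment> \<open>Both \<open>b\<close> and \<open>r a\<close> leave the middle vertex, where
        labels are distinct.\<close>
      then have "b = b'" "r a = r a'"
        by (auto intro!: inj simp: tail_rev rev_in_arcs)
      with * show "a = a' \<and> b = b'"
        by (metis rev_rev)
    qed
    have "(v, i, k) \<in> \<phi> ` arcs (square G)" for v i k
    proof -
      obtain a where "a \<in> arcs G" "tail G a = v" "l a = i"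
        by (rule obtain_arc[OF lab])
      moreover obtain b where "b \<in> arcs G" "tail G b = v" "l b = k"
        by (rule obtain_arc[OF lab])
      ultimately show ?thesis
        by (intro image_eqI[of _ _ "(r a, b)"])
          (auto simp: \<phi>_def square_def rev_rev rev_in_arcs head_rev)
    qed
    then show "\<phi> ` arcs (square G) = UNIV"
      by auto
  qed
  have "(\<Sum>e\<in>arcs (square G). x $ tail (square G) e * x $ head (square G) e)
    = (\<Sum>e\<in>arcs (square G). (\<lambda>(v, i, k). cloud l x v $ i * cloud l x v $ k) (\<phi> e))"
  proof (rule sum.cong, simp, clarify)
    fix a b assume "(a, b) \<in> arcs (square G)"
    then have ab: "a \<in> arcs G" "b \<in> arcs G" "head G a = tail G b"
      by (auto simp: square_def)
    have "fst (?R (tail G b, l b)) = head G b" "fst (?R (tail G b, l (r a))) = tail G a"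
      using fst_rotation_map[OF lab ab(2)] fst_rotation_map[OF lab rev_in_arcs[OF ab(1)]] ab
      by (simp_all add: tail_rev head_rev)
    then show "x $ tail (square G) (a, b) * x $ head (square G) (a, b)
      = (\<lambda>(v, i, k). cloud l x v $ i * cloud l x v $ k) (\<phi> (a, b))"
      by (simp add: square_def \<phi>_def cloud_def)
  qed
  also have "\<dots> = (\<Sum>(v, i, k)\<in>UNIV. cloud l x v $ i * cloud l x v $ k)"
    by (rule sum.reindex_bij_betw[OF bij])
  \<comment> \<open>The two labels range independently, so the sum factors. Of the degree
    \<open>CARD('d) * CARD('d)\<close>, one factor then divides each summand and the other the whole
    sum.\<close>
  also have "\<dots> = (\<Sum>v\<in>UNIV. (cloud l x v \<bullet> 1)\<^sup>2)"
    by (simp add: inner_vec_def power2_eq_square sum_product sum.cartesian_product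
        flip: UNIV_Times_UNIV)
  finally show ?thesis
    by (simp add: inner_laplacian sq.inner_transition_matrix[OF reg] sum_subtractf
        sum_inner_cloud[OF lab] diff_divide_distrib sum_divide_distrib)
qed

lemma inner_laplacian_derandomized_square:
  fixes l :: "'e \<Rightarrow> 'd::finite" and H :: "('d, 'f) pre_digraph" and lH :: "'f \<Rightarrow> 'c::finite"
  assumes lab: "two_way_labeling G l"
    and H: "undirected_multigraph H rH" and labH: "two_way_labeling H lH"
  shows "x \<bullet> (laplacian (derandomized_square G r l H rH lH) *v x)
    = (\<Sum>v\<in>UNIV. cloud l x v \<bullet> (laplacian H *v cloud l x v)) / real CARD('d)"
proof -
  let ?R = "rotation_map G r l" and ?RH = "rotation_map H rH lH"
  let ?D = "derandomized_square G r l H rH lH"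
  interpret H: undirected_multigraph H rH by fact
  have inv: "derand_rot ?R ?RH (derand_rot ?R ?RH e) = e" for e
    by (rule derand_rot_involution[OF rotation_map_involution[OF lab]
          H.rotation_map_involution[OF labH]])
  interpret D: undirected_multigraph ?D "derand_rot ?R ?RH"
    unfolding derandomized_square_def by (rule undirected_rot_multigraph[OF inv])
  have labD: "two_way_labeling ?D snd"
    unfolding derandomized_square_def by (rule two_way_labeling_rot_multigraph)
  have rotD: "rotation_map ?D (derand_rot ?R ?RH) snd = derand_rot ?R ?RH"
    unfolding derandomized_square_def by (rule rotation_map_rot_multigraph)
  have "x \<bullet> (transition_matrix ?D *v x)
    = (\<Sum>v\<in>UNIV. \<Sum>i\<in>UNIV. \<Sum>j\<in>UNIV. x $ v * x $ fst (derand_rot ?R ?RH (v, i, j)))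
      / real CARD('d \<times> 'c)"
    by (simp add: D.inner_transition_matrix_labels[OF labD] rotD sum.cartesian_product
        case_prod_beta flip: UNIV_Times_UNIV)
  \<comment> \<open>Here \<open>u\<close> is the start of the walk and \<open>p\<close> is the
    middle vertex with the arrival label. Once \<open>p\<close> is the summation variable,
    \<open>u\<close> is its neighbour along that label, hence a cloud entry.\<close>
  also have "(\<Sum>v\<in>UNIV. \<Sum>i\<in>UNIV. \<Sum>j\<in>UNIV. x $ v * x $ fst (derand_rot ?R ?RH (v, i, j)))
    = (\<Sum>v\<in>UNIV. \<Sum>i\<in>UNIV. (\<lambda>u p. \<Sum>j\<in>UNIV. x $ u * x $ fst (?R (fst p, fst (?RH (snd p, j)))))
        v (?R (v, i)))"
    by (simp add: derand_rot_def Let_def case_prod_beta)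
  also have "\<dots> = (\<Sum>v\<in>UNIV. \<Sum>i\<in>UNIV. \<Sum>j\<in>UNIV.
      cloud l x v $ i * cloud l x v $ fst (?RH (i, j)))"
    by (subst sum_rotation_map[OF lab]) (simp add: cloud_def)
  \<comment> \<open>The factor \<open>CARD('c)\<close> of the degree is absorbed into the transition
    matrix of \<open>H\<close>.\<close>
  also have "\<dots> / real CARD('d \<times> 'c)
    = (\<Sum>v\<in>UNIV. cloud l x v \<bullet> (transition_matrix H *v cloud l x v)) / real CARD('d)"
    by (simp add: H.inner_transition_matrix_labels[OF labH] sum_divide_distrib mult.commute)
  finally show ?thesis
    by (simp add: inner_laplacian sum_subtractf sum_inner_cloud[OF lab] diff_divide_distrib)
qed

end

section \<open>From form inequalities to spectral approximation\<close>

lemma loewner_leI: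
  fixes A B :: "real^'v^'v"
  assumes "transpose A = A" "transpose B = B"
    and "\<And>x. x \<bullet> (A *v x) \<le> x \<bullet> (B *v x)"
  shows "loewner_le A B"
  using assms
  by (simp add: loewner_le_def psd_def matrix_vector_mult_diff_rdistrib inner_diff_right
      transpose_def vec_eq_iff)

theorem theorem5p7:
  fixes G :: "('v::finite, 'e) pre_digraph" and rG :: "'e \<Rightarrow> 'e" and lG :: "'e \<Rightarrow> 'd::finite"
    and H :: "('d, 'f) pre_digraph" and rH :: "'f \<Rightarrow> 'f" and lH :: "'f \<Rightarrow> 'c::finite"
    and \<alpha> :: real
  assumes "undirected_multigraph G rG"
    and "regular G CARD('d)"
    and "aperiodic G"
    and "two_way_labeling G lG"
    and "undirected_multigraph H rH"
    and "regular H CARD('c)"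
    and "two_way_labeling H lH"
    and "lambda H \<le> \<alpha>" and "\<alpha> < 1"
  shows "spectral_approx (ln (1 / (1 - \<alpha>)))
           (laplacian (square G)) (laplacian (derandomized_square G rG lG H rH lH))"
proof -
  let ?D = "derandomized_square G rG lG H rH lH"
  let ?A = "laplacian (square G)" and ?B = "laplacian ?D"
  let ?R = "derand_rot (rotation_map G rG lG) (rotation_map H rH lH)"
  interpret G: undirected_multigraph G rG by fact
  interpret H: undirected_multigraph H rH by fact
  note labG = \<open>two_way_labeling G lG\<close> and labH = \<open>two_way_labeling H lH\<close>
  have A: "transpose ?A = ?A"
    using undirected_multigraph.transpose_laplacian[OF G.undirected_square]
      regular_square[OF assms(1,2)] .
  have inv: "?R (?R e) = e" for e
    by (rule derand_rot_involution[OF G.rotation_map_involution[OF labG]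
          H.rotation_map_involution[OF labH]])
  have "regular ?D CARD('d \<times> 'c)"
    using two_way_labeling_rot_multigraph[of ?R]
    by (simp add: two_way_labeling_def derandomized_square_def)
  then have B: "transpose ?B = ?B"
    using undirected_multigraph.transpose_laplacian[OF undirected_rot_multigraph[OF inv]]
    by (simp add: derandomized_square_def)
  have \<alpha>: "0 \<le> \<alpha>" "\<alpha> < 1"
    using lambda_nonneg[of H] assms by auto
  \<comment> \<open>This is \<open>(1 - \<alpha>) * (1 + \<alpha>) \<le> 1\<close>.\<close>
  then have le: "1 + \<alpha> \<le> 1 / (1 - \<alpha>)"
    by (simp add: field_simps)
  note bounds = H.laplacian_form_bounds[OF labH \<open>lambda H \<le> \<alpha>\<close>]
  note forms = G.inner_laplacian_square[OF labG]
    G.inner_laplacian_derandomized_square[OF labG assms(5) labH]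
  have lower: "(1 - \<alpha>) * (x \<bullet> (?A *v x)) \<le> x \<bullet> (?B *v x)" for x
    unfolding forms times_divide_eq_right sum_distrib_left
    by (intro divide_right_mono sum_mono bounds) simp
  \<comment> \<open>Enlarging the constant from \<open>1 + \<alpha>\<close> to
    \<open>1 / (1 - \<alpha>)\<close> in each summand uses that its variance term is nonnegative,
    which is \<open>bounds(1)\<close>.\<close>
  have upper: "x \<bullet> (?B *v x) \<le> 1 / (1 - \<alpha>) * (x \<bullet> (?A *v x))" for x
    unfolding forms times_divide_eq_right sum_distrib_left
    by (intro divide_right_mono sum_mono order_trans[OF bounds(3) mult_right_mono[OF le bounds(1)]])
      simp
  have exp: "exp (ln (1 / (1 - \<alpha>))) = 1 / (1 - \<alpha>)" "exp (- ln (1 / (1 - \<alpha>))) = 1 - \<alpha>"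
    using \<alpha> by (simp_all add: exp_minus)
  show ?thesis
    unfolding spectral_approx_def exp
    using lower upper A B
    by (auto intro!: loewner_leI simp: transpose_scalar scaleR_matrix_vector_assoc[symmetric])
qed

end
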